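(* Let $f_1:\mathbb{R}^{mT_f}\to\mathbb{R}$, let $f_2,h:\mathbb{R}^{pT_f}\to\mathbb{R}$ be convex and Lipschitz continuous with constants $L_{\mathrm{obj}}>0$ and $L_{\mathrm{con}}>0$ with respect to $\|\cdot\|_r$, let $\mathcal{U}\subseteq\mathbb{R}^{mT_f}$, $\beta\in(0,1)$, $\varepsilon>0$, and let $u_p\in\mathbb{R}^{mT_p}$, $y_p\in\mathbb{R}^{pT_p}$ be given. With $M,U_p,U_f,Y_p,Y_f,\hat K,\hat\xi_f^{(i)},m_f$ as defined in the context, the problem $$\begin{aligned}\min_{u_f,\,\tau,\,s_1,\dots,s_N}\;& f_1(u_f)+\frac1N\sum_{i=1}^N f_2\big(\hat K m_f+\hat\xi_f^{(i)}\big)+L_{\mathrm{obj}}\,\varepsilon\\ \text{s.t. }& u_f\in\mathcal{U},\\ &-\tau\beta+L_{\mathrm{con}}\,\varepsilon+\frac1N\sum_{i=1}^N s_i\le 0,\\ &\tau+h\big(\hat K m_f+\hat\xi_f^{(i)}\big)\le s_i,\quad i=1,\dots,N,\\ & s_i\ge 0,\quad i=1,\dots,N,\end{aligned}$$ is equivalent to the problem $$\begin{aligned}\min_{g,\,\tau,\,s_1,\dots,s_N}\;& f_1(U_fg)+\frac1N\sum_{i=1}^N f_2\big(Y_fg+Y_f(I-P)e_i\big)+L_{\mathrm{obj}}\,\varepsilon\\ \text{s.t. }& U_pg=u_p,\quad Y_pg=y_p,\quad (I-P)g=0,\quad U_fg\in\mathcal{U},\\ &-\tau\beta+L_{\mathrm{con}}\,\varepsilon+\frac1N\sum_{i=1}^N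 s_i\le 0,\\ &\tau+h\big(Y_fg+Y_f(I-P)e_i\big)\le s_i,\quad i=1,\dots,N,\\ & s_i\ge 0,\quad i=1,\dots,N,\end{aligned}$$ where $g\in\mathbb{R}^N$ and $P:=M^\dagger M$ is the orthogonal projector onto the row space of $M$. Here equivalence is under the substitution $u_f=U_fg$: $(u_f,\tau,s_1,\dots,s_N)$ is feasible for the first problem if and only if there is $g$ with $U_fg=u_f$ such that $(g,\tau,s_1,\dots,s_N)$ is feasible for the second, and corresponding feasible points have equal objective values.
   Context: An offline input-output trajectory $\{u_k^d,y_k^d\}_{k=1}^T$ with $u_k^d\in\mathbb{R}^m$, $y_k^d\in\mathbb{R}^p$ is given. Let $T_p,T_f\ge1$, $L=T_p+T_f$, $N=T-L+1\ge1$. For a sequence $z_1,\dots,z_T$ write $z_{[k,j]}=[z_k^\top\cdots z_j^\top]^\top$, and let $H_L(z)=[z_{[1,L]}\;\cdots\;z_{[T-L+1,T]}]$ be the Hankel matrix of depth $L$. Partition $H_L(u^d)=\begin{bmatrix} U_p \\ U_f \end{bmatrix}$ and $H_L(y^d)=\begin{bmatrix} Y_p \\ Y_f \end{bmatrix}$, where $U_p,Y_p$ consist of the first $T_p$ block rows and $U_f,Y_f$ of the last $T_f$ block rows. Let $M=\begin{bmatrix} U_p \\ Y_p \\ U_f \end{bmatrix}$ with Moore-Penrose pseudoinverse $M^\dagger$, $\hat K=Y_fM^\dagger$, and $\hat\xi_f^{(i)}=(Y_f-\hat KM)e_i$, $i=1,\dots,N$, with $e_i$ the $i$-th standard basis vector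 of $\mathbb{R}^N$. For a decision $u_f\in\mathbb{R}^{mT_f}$, $m_f=[u_p^\top\;y_p^\top\;u_f^\top]^\top$. $\|\cdot\|_r$ is the $\ell_r$-norm, $r\in[1,\infty]$.
   Formalization: The equivalence fails if m_f is not in the column space of M (e.g. zero data, u_p nonzero); proved instead: a corresponding g exists iff u_f is feasible and m_f lies in the range of M, so the stated equivalence holds in full when M has full row rank. *)

theory Defs
  imports "HOL-Analysis.Analysis"
begin

text \<open>
  Dimensions are index types: \<open>'m\<close> and \<open>'p\<close> index the components of inputs and outputs, the finite
  chains \<open>'tp\<close>, \<open>'tf\<close> and \<open>'n\<close> are the time steps of the past window, the time steps of the future
  window and the Hankel columns. A stacked vector in \<open>R^(m T_f)\<close> is indexed by \<open>'tf \<times> 'm\<close>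
  (time step, component).
\<close>

definition pos :: "'a::{finite,linorder} \<Rightarrow> nat" where
  "pos i = card {j. j < i}"

text \<open>Position of a step in the concatenation of the past and the future window.\<close>

definition window_pos :: "'tp::{finite,linorder} + 'tf::{finite,linorder} \<Rightarrow> nat" where
  "window_pos l = (case l of Inl i \<Rightarrow> pos i | Inr j \<Rightarrow> CARD('tp) + pos j)"

text \<open>
  Trajectories are indexed from 1 while positions are counted from 0: the first entry of the first
  column is taken from \<open>z 1\<close>.
\<close>

definition hankel ::
    "(nat \<Rightarrow> real^'a::finite)
      \<Rightarrow> real^'n::{finite,linorder}^(('tp::{finite,linorder} + 'tf::{finite,linorder}) \<times> 'a)" where
  "hankel z = (\<chi> r k. z (1 + pos k + window_pos (fst r)) $ snd r)"

definition past_rows :: "'b^(('tp::finite + 'tf::finite) \<times> 'a::finite) \<Rightarrow> 'b^('tp \<times> 'a)" where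
  "past_rows H = (\<chi> r. H $ (Inl (fst r), snd r))"

definition future_rows :: "'b^(('tp::finite + 'tf::finite) \<times> 'a::finite) \<Rightarrow> 'b^('tf \<times> 'a)" where
  "future_rows H = (\<chi> r. H $ (Inr (fst r), snd r))"

text \<open>
  Vertical stacking of three blocks: for scalar entries it concatenates vectors, for entries that are
  rows it stacks matrices.
\<close>

definition stack3 :: "'b^'i::finite \<Rightarrow> 'b^'j::finite \<Rightarrow> 'b^'k::finite \<Rightarrow> 'b^('i + ('j + 'k))" where
  "stack3 A B C = (\<chi> r. case r of Inl i \<Rightarrow> A $ i | Inr (Inl j) \<Rightarrow> B $ j | Inr (Inr k) \<Rightarrow> C $ k)"

text \<open>
  The four Penrose conditions; they have exactly one solution (\<open>is_pinv_exists\<close>, \<open>is_pinv_unique\<close>),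
  so the description in \<open>pinv\<close> below is proper.
\<close>

definition is_pinv :: "real^'n^'k \<Rightarrow> real^'k^'n \<Rightarrow> bool" where
  "is_pinv A X \<longleftrightarrow> A ** X ** A = A \<and> X ** A ** X = X
     \<and> transpose (A ** X) = A ** X \<and> transpose (X ** A) = X ** A"

lemma is_pinv_unique:
  assumes "is_pinv A X" "is_pinv A Y"
  shows "X = Y"
proof -
  have AX: "A ** X = A ** Y"
  proof -
    have "A ** X = (A ** Y) ** (A ** X)"
      using assms unfolding is_pinv_def by (simp add: matrix_mul_assoc)
    also have "\<dots> = transpose (A ** Y) ** transpose (A ** X)"
      using assms unfolding is_pinv_def by simp
    also have "\<dots> = transpose ((A ** X) ** (A ** Y))"
      by (simp add: matrix_transpose_mul)
    also have "(A ** X) ** (A ** Y) = A ** Y"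
      using assms unfolding is_pinv_def by (simp add: matrix_mul_assoc)
    finally show ?thesis using assms unfolding is_pinv_def by simp
  qed
  have XA: "X ** A = Y ** A"
  proof -
    have "X ** A = (X ** A) ** (Y ** A)"
      using assms unfolding is_pinv_def by (metis matrix_mul_assoc)
    also have "\<dots> = transpose (X ** A) ** transpose (Y ** A)"
      using assms unfolding is_pinv_def by simp
    also have "\<dots> = transpose ((Y ** A) ** (X ** A))"
      by (simp add: matrix_transpose_mul)
    also have "(Y ** A) ** (X ** A) = Y ** A"
      using assms unfolding is_pinv_def by (metis matrix_mul_assoc)
    finally show ?thesis using assms unfolding is_pinv_def by simp
  qed
  have "X = X ** A ** X" using assms unfolding is_pinv_def by simp
  also have "\<dots> = Y ** A ** X" by (simp add: XA)
  also have "\<dots> = Y ** (A ** X)" by (simp add: matrix_mul_assoc)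
  also have "\<dots> = Y ** A ** Y" by (simp add: AX matrix_mul_assoc)
  also have "\<dots> = Y" using assms unfolding is_pinv_def by simp
  finally show ?thesis .
qed

lemma inner_transpose_mult: "x \<bullet> (A *v y) = (transpose A *v x) \<bullet> y"
  for A :: "real^'n^'k"
  by (simp add: dot_lmul_matrix)

lemma is_pinv_exists: "\<exists>X. is_pinv A X" for A :: "real^'n^'k"
proof -
  define S where "S = range ((*v) (transpose A))"
  have sub: "subspace S"
    unfolding S_def by (rule linear_subspace_image) auto
  have sub': "subspace (range ((*v) A))"
    by (rule linear_subspace_image) auto
  have kerS: "s \<bullet> k = 0" if "s \<in> S" "A *v k = 0" for s k
    using that inner_transpose_mult[of _ A k] unfolding S_def by force
  have kerI: "A *v k = 0" if "\<And>s. s \<in> S \<Longrightarrow> k \<bullet> s = 0" for k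
  proof -
    have "(A *v k) \<bullet> (A *v k) = (transpose A *v (A *v k)) \<bullet> k"
      by (rule inner_transpose_mult)
    also have "\<dots> = 0"
      using that[of "transpose A *v (A *v k)"] by (simp add: S_def inner_commute)
    finally show ?thesis by simp
  qed
  have ex: "\<exists>x\<in>S. \<forall>v. (y - A *v x) \<bullet> (A *v v) = 0" for y
  proof -
    obtain a b where a: "a \<in> span (range ((*v) A))"
      and b: "\<And>w. w \<in> span (range ((*v) A)) \<Longrightarrow> orthogonal b w" and y: "y = a + b"
      using orthogonal_subspace_decomp_exists[of "range ((*v) A)" y] by blast
    have "span (range ((*v) A)) = range ((*v) A)" using sub' by (simp only: span_eq_iff)
    with a obtain w where w: "a = A *v w" by auto
    obtain s k where s: "s \<in> span S" and k: "\<And>v. v \<in> span S \<Longrightarrow> orthogonal k v" and wk: "w = s + k"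
      using orthogonal_subspace_decomp_exists[of S w] by blast
    have sp: "span S = S" using sub by (simp only: span_eq_iff)
    have "A *v k = 0" using k sp by (intro kerI) (auto simp: orthogonal_def)
    then have "y - A *v s = b"
      using y w wk by (simp add: matrix_vector_right_distrib)
    moreover have "b \<bullet> (A *v v) = 0" for v
      using b[of "A *v v"] by (simp add: span_base orthogonal_def)
    ultimately show ?thesis using s sp by auto
  qed
  then obtain f where fS: "\<And>y. f y \<in> S"
    and fo: "\<And>y v. (y - A *v f y) \<bullet> (A *v v) = 0" by metis
  have uniq: "x = x'" if "x \<in> S" "x' \<in> S" "A *v x = A *v x'" for x x'
  proof -
    have "x - x' \<in> S" using that sub by (simp add: subspace_diff)
    moreover have "A *v (x - x') = 0" using that by (simp add: matrix_vector_mult_diff_distrib)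
    ultimately have "(x - x') \<bullet> (x - x') = 0" by (rule kerS)
    then show ?thesis by simp
  qed
  have Af: "A *v x = A *v f y" if "\<And>v. (y - A *v x) \<bullet> (A *v v) = 0" for x y
  proof -
    have "(A *v (x - f y)) \<bullet> (A *v v) = 0" for v
      using that[of v] fo[of y v]
      by (simp add: matrix_vector_mult_diff_distrib inner_diff_left)
    then have "A *v (x - f y) = 0" by (metis inner_eq_zero_iff)
    then show ?thesis by (simp add: matrix_vector_mult_diff_distrib)
  qed
  have char: "f y = x" if "x \<in> S" "\<And>v. (y - A *v x) \<bullet> (A *v v) = 0" for x y
    using uniq[OF that(1) fS[of y] Af] that(2) by simp
  have lin: "linear f"
  proof (rule linearI)
    show "f (x + y) = f x + f y" for x y
    proof (rule char)
      show "f x + f y \<in> S" using fS sub by (simp add: subspace_add)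
      show "(x + y - A *v (f x + f y)) \<bullet> (A *v v) = 0" for v
        using fo[of x v] fo[of y v]
        by (simp add: matrix_vector_right_distrib inner_diff_left inner_add_left)
    qed
    show "f (c *\<^sub>R x) = c *\<^sub>R f x" for c x
    proof (rule char)
      show "c *\<^sub>R f x \<in> S" using fS sub by (simp add: subspace_scale)
      show "(c *\<^sub>R x - A *v (c *\<^sub>R f x)) \<bullet> (A *v v) = 0" for v
        using fo[of x v]
        by (simp add: matrix_vector_mult_scaleR inner_diff_left)
    qed
  qed
  define X where "X = matrix f"
  have X: "X *v y = f y" for y unfolding X_def using lin by (simp add: matrix_works)
  have AfA: "A *v f (A *v x) = A *v x" for x
    using Af[of "A *v x" x] by simp
  have "A ** X ** A = A"
    by (simp add: matrix_eq matrix_vector_mul_assoc[symmetric] X AfA)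
  moreover have "X ** A ** X = X"
    by (simp add: matrix_eq matrix_vector_mul_assoc[symmetric] X) (metis uniq fS AfA)
  moreover have "transpose (A ** X) = A ** X"
  proof -
    have "(transpose (A ** X) *v y) \<bullet> z = ((A ** X) *v y) \<bullet> z" for y z
    proof -
      have "(transpose (A ** X) *v y) \<bullet> z = y \<bullet> (A *v f z)"
        by (simp add: dot_lmul_matrix matrix_vector_mul_assoc[symmetric] X)
      also have "\<dots> = (A *v f y) \<bullet> (A *v f z)"
        using fo[of y "f z"] by (simp add: inner_diff_left)
      also have "\<dots> = (A *v f y) \<bullet> z"
        using fo[of z "f y"] by (simp add: inner_diff_right inner_commute[of _ "A *v f y"])
      finally show ?thesis by (simp add: matrix_vector_mul_assoc[symmetric] X)
    qed
    then show ?thesis by (metis matrix_eq vector_eq_rdot)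
  qed
  moreover have "transpose (X ** A) = X ** A"
  proof -
    have e: "f (A *v y) \<bullet> z = f (A *v y) \<bullet> f (A *v z)" for y z
    proof -
      have "f (A *v y) \<bullet> (z - f (A *v z)) = 0"
        by (rule kerS[OF fS]) (simp add: matrix_vector_mult_diff_distrib AfA)
      then show ?thesis by (simp add: inner_diff_right)
    qed
    have "(transpose (X ** A) *v y) \<bullet> z = ((X ** A) *v y) \<bullet> z" for y z
      using e[of y z] e[of z y] inner_commute[of y "f (A *v z)"]
        inner_commute[of "f (A *v y)" "f (A *v z)"]
      by (simp add: dot_lmul_matrix matrix_vector_mul_assoc[symmetric] X)
    then show ?thesis by (metis matrix_eq vector_eq_rdot)
  qed
  ultimately show ?thesis unfolding is_pinv_def by blast
qed

definition pinv :: "real^'n^'k \<Rightarrow> real^'k^'n" where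
  "pinv A = (THE X. is_pinv A X)"

lemma is_pinv_pinv: "is_pinv A (pinv A)"
  unfolding pinv_def by (metis is_pinv_exists is_pinv_unique theI)

definition orthogonal_projector_onto :: "real^'n^'n \<Rightarrow> (real^'n) set \<Rightarrow> bool" where
  "orthogonal_projector_onto P S \<longleftrightarrow>
     (\<forall>x. P *v x \<in> S \<and> (\<forall>y\<in>S. orthogonal (x - P *v x) y))"


definition lr_norm :: "ereal \<Rightarrow> real^'k::finite \<Rightarrow> real" where
  "lr_norm r x =
     (if r = \<infinity> then Max (range (\<lambda>i. \<bar>x $ i\<bar>))
      else (\<Sum>i\<in>UNIV. \<bar>x $ i\<bar> powr real_of_ereal r) powr (1 / real_of_ereal r))"

definition lr_lipschitz :: "ereal \<Rightarrow> real \<Rightarrow> (real^'k::finite \<Rightarrow> real) \<Rightarrow> bool" where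
  "lr_lipschitz r C f \<longleftrightarrow> (\<forall>x y. \<bar>f x - f y\<bar> \<le> C * lr_norm r (x - y))"


text \<open>
  The problem in the predicted input \<open>uf\<close>; \<open>\<xi> i\<close> is the \<open>i\<close>-th residual sample.
\<close>

definition objective_uf ::
    "real^('i::finite + ('j::finite + 'k::finite))^'q::finite \<Rightarrow> ('n::finite \<Rightarrow> real^'q)
      \<Rightarrow> real^'i \<Rightarrow> real^'j \<Rightarrow> (real^'k \<Rightarrow> real) \<Rightarrow> (real^'q \<Rightarrow> real) \<Rightarrow> real \<Rightarrow> real
      \<Rightarrow> real^'k \<Rightarrow> real" where
  "objective_uf K \<xi> up yp f1 f2 Lobj \<epsilon> uf =
     f1 uf + (1 / real CARD('n)) * (\<Sum>i\<in>UNIV. f2 (K *v stack3 up yp uf + \<xi> i)) + Lobj * \<epsilon>"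

definition feasible_uf ::
    "real^('i::finite + ('j::finite + 'k::finite))^'q::finite \<Rightarrow> ('n::finite \<Rightarrow> real^'q)
      \<Rightarrow> real^'i \<Rightarrow> real^'j \<Rightarrow> (real^'k) set \<Rightarrow> (real^'q \<Rightarrow> real) \<Rightarrow> real \<Rightarrow> real \<Rightarrow> real
      \<Rightarrow> real^'k \<Rightarrow> real \<Rightarrow> real^'n \<Rightarrow> bool" where
  "feasible_uf K \<xi> up yp U h Lcon \<epsilon> \<beta> uf \<tau> s \<longleftrightarrow>
     uf \<in> U
     \<and> - \<tau> * \<beta> + Lcon * \<epsilon> + (1 / real CARD('n)) * (\<Sum>i\<in>UNIV. s $ i) \<le> 0
     \<and> (\<forall>i. \<tau> + h (K *v stack3 up yp uf + \<xi> i) \<le> s $ i)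
     \<and> (\<forall>i. s $ i \<ge> 0)"

text \<open>The problem in the combination vector \<open>g\<close> of Hankel columns; \<open>axis i 1\<close> is \<open>e_i\<close>.\<close>

definition objective_g ::
    "real^'n::finite^'k::finite \<Rightarrow> real^'n^'q::finite \<Rightarrow> real^'n^'n
      \<Rightarrow> (real^'k \<Rightarrow> real) \<Rightarrow> (real^'q \<Rightarrow> real) \<Rightarrow> real \<Rightarrow> real \<Rightarrow> real^'n \<Rightarrow> real" where
  "objective_g Uf Yf P f1 f2 Lobj \<epsilon> g =
     f1 (Uf *v g)
     + (1 / real CARD('n)) * (\<Sum>i\<in>UNIV. f2 (Yf *v g + (Yf ** (mat 1 - P)) *v axis i 1))
     + Lobj * \<epsilon>"

definition feasible_g ::
    "real^'n::finite^'i::finite \<Rightarrow> real^'n^'j::finite \<Rightarrow> real^'n^'k::finite \<Rightarrow> real^'n^'q::finite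
      \<Rightarrow> real^'n^'n \<Rightarrow> real^'i \<Rightarrow> real^'j
      \<Rightarrow> (real^'k) set \<Rightarrow> (real^'q \<Rightarrow> real) \<Rightarrow> real \<Rightarrow> real \<Rightarrow> real
      \<Rightarrow> real^'n \<Rightarrow> real \<Rightarrow> real^'n \<Rightarrow> bool" where
  "feasible_g Up Yp Uf Yf P up yp U h Lcon \<epsilon> \<beta> g \<tau> s \<longleftrightarrow>
     Up *v g = up \<and> Yp *v g = yp \<and> (mat 1 - P) *v g = 0 \<and> Uf *v g \<in> U
     \<and> - \<tau> * \<beta> + Lcon * \<epsilon> + (1 / real CARD('n)) * (\<Sum>i\<in>UNIV. s $ i) \<le> 0
     \<and> (\<forall>i. \<tau> + h (Yf *v g + (Yf ** (mat 1 - P)) *v axis i 1) \<le> s $ i)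
     \<and> (\<forall>i. s $ i \<ge> 0)"

end

theory Submission
  imports Defs
begin

text \<open>
  The constraint \<open>(I - P) g = 0\<close> selects, among all \<open>g\<close> with \<open>M g = m\<close>, the single solution
  \<open>g = M\<^sup>\<dagger> m\<close>, and for this one \<open>K m = Y\<^sub>f M\<^sup>\<dagger> m = Y\<^sub>f g\<close>. Since also \<open>K M = Y\<^sub>f P\<close>, the predicted samples
  of both problems coincide. A solution of \<open>M g = m\<close> exists exactly when \<open>m\<close> lies in the range of \<open>M\<close>.
\<close>

lemma stack3_mult: "stack3 A B C *v x = stack3 (A *v x) (B *v x) (C *v x)"
  by (simp add: vec_eq_iff stack3_def matrix_vector_mult_def split: sum.split)

lemma stack3_eq_iff: "stack3 a b c = stack3 a' b' c' \<longleftrightarrow> a = a' \<and> b = b' \<and> c = c'"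
  by (auto simp: stack3_def vec_eq_iff split: sum.split)

text \<open>Two Penrose conditions suffice: symmetry of \<open>pinv A ** A\<close> puts its values
  in the row space, and \<open>A ** pinv A ** A = A\<close> makes the residual orthogonal to every
  row.\<close>

lemma pinv_projector: "orthogonal_projector_onto (pinv A ** A) (span (rows A))"
  for A :: "real^'n^'k"
  unfolding orthogonal_projector_onto_def
proof (intro allI conjI ballI)
  fix x y :: "real^'n"
  \<comment> \<open>By symmetry the product can be rewritten with \<open>transpose A\<close> as its
    left factor, whose column space is the row space of \<open>A\<close>.\<close>
  have "pinv A ** A = transpose A ** transpose (pinv A)"
    using is_pinv_pinv[of A] by (simp add: is_pinv_def flip: matrix_transpose_mul)
  then have "(pinv A ** A) *v x = transpose A *v (transpose (pinv A) *v x)"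
    by (simp only: matrix_vector_mul_assoc)
  then show "(pinv A ** A) *v x \<in> span (rows A)"
    using matrix_vector_mult_in_columnspace[of "transpose A"] by (metis columns_transpose)
  have "A *v (x - (pinv A ** A) *v x) = 0"
    using is_pinv_pinv[of A]
    by (simp add: is_pinv_def matrix_vector_mult_diff_distrib matrix_vector_mul_assoc
        matrix_mul_assoc)
  then have "A $ i \<bullet> (x - (pinv A ** A) *v x) = 0" for i
    by (metis matrix_vector_mul_component zero_index)
  then have "orthogonal (x - (pinv A ** A) *v x) (row i A)" for i
    by (simp add: orthogonal_def row_def inner_commute)
  moreover assume "y \<in> span (rows A)"
  ultimately show "orthogonal (x - (pinv A ** A) *v x) y"
    by (auto simp: rows_def intro: orthogonal_to_span)
qed

lemma pinv_mult_range:
  assumes "b \<in> range ((*v) A)"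
  shows "A *v (pinv A *v b) = b"
  using assms is_pinv_pinv[of A]
  by (auto simp: is_pinv_def matrix_vector_mul_assoc matrix_mul_assoc)

text \<open>Given \<open>A *v x = b\<close>, the projector equation reads
  \<open>x - pinv A *v b = 0\<close>. Conversely, \<open>pinv A *v b\<close> solves the system only
  for \<open>b\<close> in the range, hence the range condition.\<close>

lemma pinv_solution_iff:
  "A *v x = b \<and> (mat 1 - pinv A ** A) *v x = 0 \<longleftrightarrow> b \<in> range ((*v) A) \<and> x = pinv A *v b"
  for A :: "real^'n^'k"
proof -
  have "(mat 1 - pinv A ** A) *v x = x - pinv A *v (A *v x)"
    by (simp add: matrix_vector_mult_diff_rdistrib matrix_vector_mul_assoc)
  then show ?thesis
    using pinv_mult_range[of b A] by auto
qed

lemma prediction_samples_eq: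
  fixes Yf :: "real^'n::finite^'q::finite" and M :: "real^'n^'k"
  assumes "M *v g = m" "(mat 1 - pinv M ** M) *v g = 0"
  shows "(Yf ** pinv M) *v m + (Yf - Yf ** pinv M ** M) *v v
    = Yf *v g + (Yf ** (mat 1 - pinv M ** M)) *v v"
proof -
  have "g = pinv M *v m"
    using assms pinv_solution_iff by blast
  then show ?thesis
    by (simp add: matrix_vector_mult_diff_rdistrib matrix_vector_mult_diff_distrib
        flip: matrix_vector_mul_assoc)
qed

theorem theorem2:
  fixes ud :: "nat \<Rightarrow> real^'m::finite" and yd :: "nat \<Rightarrow> real^'p::finite"
    and T :: nat
    and Hu :: "real^'n::{finite,linorder}^(('tp::{finite,linorder} + 'tf::{finite,linorder}) \<times> 'm)"
    and Hy :: "real^'n::{finite,linorder}^(('tp + 'tf) \<times> 'p)"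
    and Up :: "real^'n::{finite,linorder}^('tp \<times> 'm)"
    and Uf :: "real^'n::{finite,linorder}^('tf \<times> 'm)"
    and Yp :: "real^'n::{finite,linorder}^('tp \<times> 'p)"
    and Yf :: "real^'n::{finite,linorder}^('tf \<times> 'p)"
    and M :: "real^'n::{finite,linorder}^(('tp \<times> 'm) + (('tp \<times> 'p) + ('tf \<times> 'm)))"
    and K :: "real^(('tp \<times> 'm) + (('tp \<times> 'p) + ('tf \<times> 'm)))^('tf \<times> 'p)"
    and P :: "real^'n::{finite,linorder}^'n::{finite,linorder}"
    and \<xi> :: "'n \<Rightarrow> real^('tf \<times> 'p)"
    and r :: ereal
    and f1 :: "real^('tf \<times> 'm) \<Rightarrow> real"
    and f2 h :: "real^('tf \<times> 'p) \<Rightarrow> real"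
    and Lobj Lcon \<beta> \<epsilon> :: real
    and U :: "(real^('tf \<times> 'm)) set"
    and up :: "real^('tp \<times> 'm)" and yp :: "real^('tp \<times> 'p)"
  assumes "CARD('tp) + CARD('tf) \<le> T"
    and "CARD('n) = T - (CARD('tp) + CARD('tf)) + 1"
    and "Hu = hankel ud" and "Hy = hankel yd"
    and "Up = past_rows Hu" and "Uf = future_rows Hu"
    and "Yp = past_rows Hy" and "Yf = future_rows Hy"
    and "M = stack3 Up Yp Uf"
    and "K = Yf ** pinv M"
    and "P = pinv M ** M"
    and "\<And>i. \<xi> i = (Yf - K ** M) *v axis i 1"
    and "1 \<le> r"
    and "convex_on UNIV f2" and "Lobj > 0" and "lr_lipschitz r Lobj f2"
    and "convex_on UNIV h" and "Lcon > 0" and "lr_lipschitz r Lcon h"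
    and "0 < \<beta>" and "\<beta> < 1" and "\<epsilon> > 0"
  shows "orthogonal_projector_onto P (span (rows M))
    \<and> (rank M = CARD(('tp \<times> 'm) + (('tp \<times> 'p) + ('tf \<times> 'm))) \<longrightarrow>
        (\<forall>uf \<tau> s. feasible_uf K \<xi> up yp U h Lcon \<epsilon> \<beta> uf \<tau> s \<longleftrightarrow>
          (\<exists>g. Uf *v g = uf \<and> feasible_g Up Yp Uf Yf P up yp U h Lcon \<epsilon> \<beta> g \<tau> s)))
    \<and> (\<forall>uf \<tau> s. (\<exists>g. Uf *v g = uf \<and> feasible_g Up Yp Uf Yf P up yp U h Lcon \<epsilon> \<beta> g \<tau> s) \<longleftrightarrow>
          feasible_uf K \<xi> up yp U h Lcon \<epsilon> \<beta> uf \<tau> s \<and> stack3 up yp uf \<in> range ((*v) M))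
    \<and> (\<forall>uf g \<tau> s. Uf *v g = uf \<and> feasible_g Up Yp Uf Yf P up yp U h Lcon \<epsilon> \<beta> g \<tau> s \<longrightarrow>
          objective_uf K \<xi> up yp f1 f2 Lobj \<epsilon> uf = objective_g Uf Yf P f1 f2 Lobj \<epsilon> g)"
proof -
  \<comment> \<open>The three block equations merge into one system in \<open>M\<close>; under it
    and the projector equation, \<open>h\<close> receives the same arguments in both
    problems.\<close>
  have feasible_iff: "Uf *v g = uf \<and> feasible_g Up Yp Uf Yf P up yp U h Lcon \<epsilon> \<beta> g \<tau> s \<longleftrightarrow>
      M *v g = stack3 up yp uf \<and> (mat 1 - P) *v g = 0 \<and> feasible_uf K \<xi> up yp U h Lcon \<epsilon> \<beta> uf \<tau> s"
    for uf g \<tau> s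
    using prediction_samples_eq[of M g "stack3 up yp uf" Yf]
    by (auto simp: feasible_g_def feasible_uf_def assms(9-12) stack3_mult stack3_eq_iff)
  \<comment> \<open>Feasibility in \<open>uf\<close> no longer involves \<open>g\<close>, so only
    solvability for \<open>g\<close> remains; the witness is
    \<open>pinv M *v stack3 up yp uf\<close>.\<close>
  have ex_iff: "(\<exists>g. Uf *v g = uf \<and> feasible_g Up Yp Uf Yf P up yp U h Lcon \<epsilon> \<beta> g \<tau> s) \<longleftrightarrow>
      feasible_uf K \<xi> up yp U h Lcon \<epsilon> \<beta> uf \<tau> s \<and> stack3 up yp uf \<in> range ((*v) M)" for uf \<tau> s
    unfolding feasible_iff using pinv_solution_iff[of M _ "stack3 up yp uf"] assms(11) by blast
  have "objective_uf K \<xi> up yp f1 f2 Lobj \<epsilon> uf = objective_g Uf Yf P f1 f2 Lobj \<epsilon> g"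
    if "Uf *v g = uf" "feasible_g Up Yp Uf Yf P up yp U h Lcon \<epsilon> \<beta> g \<tau> s" for uf g \<tau> s
    using prediction_samples_eq[of M g "stack3 up yp uf" Yf] feasible_iff[of g uf \<tau> s] that
    by (simp add: objective_uf_def objective_g_def assms(10-12))
  \<comment> \<open>Full row rank makes \<open>M\<close> surjective, so the range condition in
    \<open>ex_iff\<close> holds for every \<open>uf\<close> and the plain equivalence
    follows.\<close>
  then show ?thesis
    using pinv_projector[of M] ex_iff full_rank_surjective[of M] assms(11) by auto
qed

end
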